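(* Let $\tilde{A}=\widehat{A}+\epsilon_2\widehat{A}_0=A_{0}+\epsilon_1 A_{1}+\epsilon_2 A_{2}+\epsilon_1\epsilon_2 A_{3}$ be an $n\times n$ hyper-dual matrix such that the dual index of $\widehat{A}$ is 1, and let $\tilde b\in\tilde{\mathbb{R}}^n$. If the hyper-dual group inverse $\tilde A^{\#}$ of $\tilde{A}$ exists, then $\tilde{A}^{\#}\tilde{b}$ is the unique solution in $R(\tilde{A})$ of the group normal equation $$\tilde{A}^2\tilde{x}=\tilde{A}\tilde{b}.$$
   Context: Hyper-dual numbers are elements $a_0+\epsilon_1a_1+\epsilon_2a_2+\epsilon_1\epsilon_2a_3$ with $a_i\in\mathbb{R}$, where $\epsilon_1,\epsilon_2$ commute, $\epsilon_1^2=\epsilon_2^2=0$ and $\epsilon_1\epsilon_2\ne0$ (i.e. the commutative ring $\mathbb{R}[\epsilon_1,\epsilon_2]/(\epsilon_1^2,\epsilon_2^2)$). An $n\times n$ hyper-dual matrix is $\tilde A=\widehat A+\epsilon_2\widehat A_0$ with $\widehat A=A_0+\epsilon_1A_1$, $\widehat A_0=A_2+\epsilon_1A_3$ dual matrices, $A_i\in\mathbb{R}^{n\times n}$. $\tilde{\mathbb{R}}^n$ is the set of $n$-dimensional hyper-dual column vectors, and $R(\tilde A)=\{\tilde A\tilde z:\tilde z\in\tilde{\mathbb{R}}^n\}$. The hyper-dual group inverse of $\tilde A$ is the (unique, if it exists) hyper-dual matrix $\tilde A^{\#}=\tilde X$ with $\tilde{A}\tilde{X}\tilde{A}=\tilde{A}$,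 $\tilde{X}\tilde{A}\tilde{X}=\tilde{X}$, $\tilde{A}\tilde{X}=\tilde{X}\tilde{A}$. A dual matrix $\widehat A$ has dual index 1 if the range spaces of $\widehat A^2$ and $\widehat A$ (as maps on dual vectors) coincide. *)

theory Defs imports "HOL-Analysis.Analysis" begin

text \<open>
  Dual numbers a + eps c with eps * eps = 0 over a commutative ring. Hyper-dual numbers are dual
  numbers over the real dual numbers: the inner unit is eps1 and the outer unit is eps2, i.e.
  a0 + eps1 a1 + eps2 a2 + eps1 eps2 a3 is encoded as (a0 + eps1 a1) + eps2 (a2 + eps1 a3).
\<close>

datatype 'a dual_num = Dual (std_part: 'a) (dual_part: 'a)

instantiation dual_num :: (comm_ring_1) comm_ring_1
begin

definition zero_dual_num :: "'a dual_num" where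
  "0 = Dual 0 0"

definition one_dual_num :: "'a dual_num" where
  "1 = Dual 1 0"

definition plus_dual_num :: "'a dual_num \<Rightarrow> 'a dual_num \<Rightarrow> 'a dual_num" where
  "x + y = Dual (std_part x + std_part y) (dual_part x + dual_part y)"

definition uminus_dual_num :: "'a dual_num \<Rightarrow> 'a dual_num" where
  "- x = Dual (- std_part x) (- dual_part x)"

definition minus_dual_num :: "'a dual_num \<Rightarrow> 'a dual_num \<Rightarrow> 'a dual_num" where
  "x - y = Dual (std_part x - std_part y) (dual_part x - dual_part y)"

definition times_dual_num :: "'a dual_num \<Rightarrow> 'a dual_num \<Rightarrow> 'a dual_num" where
  "x * y = Dual (std_part x * std_part y)
                (std_part x * dual_part y + dual_part x * std_part y)"

instance
  by standard
    (simp_all add: zero_dual_num_def one_dual_num_def plus_dual_num_def uminus_dual_num_def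
      minus_dual_num_def times_dual_num_def algebra_simps)

end

type_synonym dual_real = "real dual_num"
type_synonym hyper_dual = "real dual_num dual_num"

definition hd_real :: "real \<Rightarrow> hyper_dual" where
  "hd_real a = Dual (Dual a 0) 0"

definition eps1 :: hyper_dual where
  "eps1 = Dual (Dual 0 1) 0"

definition eps2 :: hyper_dual where
  "eps2 = Dual 0 1"

lemma eps_mult:
  "eps1 * eps1 = 0" "eps2 * eps2 = 0" "eps1 * eps2 \<noteq> 0"
  by (simp_all add: eps1_def eps2_def times_dual_num_def zero_dual_num_def one_dual_num_def
      plus_dual_num_def)

lemma hyper_dual_expansion:
  "Dual (Dual a0 a1) (Dual a2 a3)
     = hd_real a0 + eps1 * hd_real a1 + eps2 * hd_real a2 + eps1 * eps2 * hd_real a3"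
  by (simp add: hd_real_def eps1_def eps2_def times_dual_num_def zero_dual_num_def
      one_dual_num_def plus_dual_num_def)

text \<open>The matrix B + eps C. Applied to real matrices, eps is eps1; applied to dual matrices,
  eps is eps2.\<close>

definition dual_matrix :: "'a ^ 'n ^ 'm \<Rightarrow> 'a ^ 'n ^ 'm \<Rightarrow> 'a dual_num ^ 'n ^ 'm" where
  "dual_matrix B C = (\<chi> i j. Dual (B $ i $ j) (C $ i $ j))"

definition mat_range :: "'a::comm_ring_1 ^ 'n ^ 'm \<Rightarrow> ('a ^ 'm) set" where
  "mat_range A = range (\<lambda>z. A *v z)"

definition dual_index_one :: "dual_real ^ 'n ^ 'n \<Rightarrow> bool" where
  "dual_index_one A \<longleftrightarrow> mat_range (A ** A) = mat_range A"

definition is_group_inverse :: "'a::comm_ring_1 ^ 'n ^ 'n \<Rightarrow> 'a ^ 'n ^ 'n \<Rightarrow> bool" where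
  "is_group_inverse A X \<longleftrightarrow> A ** X ** A = A \<and> X ** A ** X = X \<and> A ** X = X ** A"

text \<open>Unspecified if no group inverse exists.\<close>

definition group_inverse :: "'a::comm_ring_1 ^ 'n ^ 'n \<Rightarrow> 'a ^ 'n ^ 'n" where
  "group_inverse A = (THE X. is_group_inverse A X)"

end

theory Submission imports Defs begin

text \<open>Let \<open>X\<close> be a group inverse of \<open>A\<close>. Since \<open>X\<close>
  commutes with \<open>A\<close>, the idempotent \<open>X ** A\<close> fixes \<open>R(A)\<close>
  pointwise, because \<open>X ** A ** A = A\<close>. Hence on \<open>R(A)\<close> the map
  \<open>A ** A\<close> is inverted by \<open>X ** X\<close>, and the normal equation there forces
  \<open>x = X *v (X *v (A *v b)) = X *v b\<close>; this and its converse are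
  \<open>group_normal_equation_iff\<close>. The argument is pure ring algebra, so it is carried out
  over any commutative ring and then applied to hyper-dual numbers.\<close>

lemma is_group_inverse_unique:
  fixes A :: "'a::comm_ring_1 ^ 'n ^ 'n"
  assumes X: "is_group_inverse A X" and Y: "is_group_inverse A Y"
  shows "X = Y"
proof -
  have X': "A ** X ** A = A" "X ** A ** X = X" "A ** X = X ** A"
    and Y': "A ** Y ** A = A" "Y ** A ** Y = Y" "A ** Y = Y ** A"
    using X Y by (auto simp: is_group_inverse_def)
  \<comment> \<open>Both inverses induce the same idempotent: inserting
    \<open>A = A ** Y ** A\<close> and commuting each factor makes \<open>A ** X ** A\<close>
    appear, which collapses to \<open>A\<close>.\<close>
  have "A ** X = (A ** Y ** A) ** X"
    by (simp only: Y'(1))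
  also have "\<dots> = (A ** Y) ** (A ** X)"
    by (simp only: matrix_mul_assoc)
  also have "\<dots> = (Y ** A) ** (X ** A)"
    by (simp only: X'(3) Y'(3))
  also have "\<dots> = Y ** (A ** X ** A)"
    by (simp only: matrix_mul_assoc)
  also have "\<dots> = Y ** A"
    by (simp only: X'(1))
  finally have projections: "A ** X = Y ** A" .
  have "X = X ** (A ** X)"
    using X'(2) by (simp only: matrix_mul_assoc)
  also have "\<dots> = X ** (A ** Y)"
    by (simp only: projections Y'(3))
  also have "\<dots> = (A ** X) ** Y"
    by (simp only: matrix_mul_assoc X'(3))
  also have "\<dots> = Y"
    by (simp only: projections Y'(2))
  finally show ?thesis .
qed

lemma group_inverse_eqI:
  assumes "is_group_inverse A X"
  shows "group_inverse A = X"
  unfolding group_inverse_def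
  using assms by (blast intro: is_group_inverse_unique)

text \<open>Commuting turns \<open>X = X ** A ** X\<close> into \<open>X = A ** X ** X\<close>, so
  \<open>X *v (X *v b)\<close> is a preimage.\<close>

lemma group_inverse_mult_in_mat_range:
  fixes A :: "'a::comm_ring_1 ^ 'n ^ 'n"
  assumes "is_group_inverse A X"
  shows "X *v b \<in> mat_range A"
proof -
  have "X ** A ** X = X" "A ** X = X ** A"
    using assms by (auto simp: is_group_inverse_def)
  then have "X *v b = A *v (X *v (X *v b))"
    by (metis matrix_mul_assoc matrix_vector_mul_assoc)
  then show ?thesis
    unfolding mat_range_def by (rule range_eqI)
qed

lemma group_normal_equation_iff:
  fixes A :: "'a::comm_ring_1 ^ 'n ^ 'n"
  assumes "is_group_inverse A X" and "x \<in> mat_range A"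
  shows "(A ** A) *v x = A *v b \<longleftrightarrow> x = X *v b"
proof -
  have X: "A ** X ** A = A" "X ** A ** X = X" "A ** X = X ** A"
    using assms(1) by (auto simp: is_group_inverse_def)
  have XAA: "X ** A ** A = A" and XXA: "X ** X ** A = X"
    using X by (simp, metis X(2,3) matrix_mul_assoc)
  show ?thesis
  proof
    assume eq: "(A ** A) *v x = A *v b"
    obtain z where z: "x = A *v z"
      using assms(2) unfolding mat_range_def by blast
    have "x = (X ** A) *v x"
      by (simp add: z matrix_vector_mul_assoc XAA)
    \<comment> \<open>Replacing \<open>A\<close> by \<open>X ** A ** A\<close> inside
      \<open>X ** A\<close> produces the left side of the normal equation.\<close>
    also have "\<dots> = X *v (X *v ((A ** A) *v x))"
      by (metis XAA matrix_mul_assoc matrix_vector_mul_assoc)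
    also have "\<dots> = X *v b"
      by (simp only: eq matrix_vector_mul_assoc matrix_mul_assoc XXA)
    finally show "x = X *v b" .
  next
    assume "x = X *v b"
    \<comment> \<open>Here \<open>A ** A ** X = A ** X ** A = A\<close>.\<close>
    then show "(A ** A) *v x = A *v b"
      by (metis X(1,3) matrix_mul_assoc matrix_vector_mul_assoc)
  qed
qed

theorem theorem4p3:
  fixes A0 A1 A2 A3 :: "real ^ 'n ^ 'n"
    and Ahat Ahat0 :: "dual_real ^ 'n ^ 'n"
    and A :: "hyper_dual ^ 'n ^ 'n"
    and b :: "hyper_dual ^ 'n"
  assumes "Ahat = dual_matrix A0 A1"
    and "Ahat0 = dual_matrix A2 A3"
    and "A = dual_matrix Ahat Ahat0"
    and "dual_index_one Ahat"
    and "\<exists>X. is_group_inverse A X"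
  shows "group_inverse A *v b \<in> mat_range A
    \<and> (A ** A) *v (group_inverse A *v b) = A *v b
    \<and> (\<forall>x \<in> mat_range A. (A ** A) *v x = A *v b \<longrightarrow> x = group_inverse A *v b)"
proof -
  obtain X where X: "is_group_inverse A X"
    using assms(5) by blast
  have "X *v b \<in> mat_range A"
    using X by (rule group_inverse_mult_in_mat_range)
  then show ?thesis
    using group_normal_equation_iff[OF X] by (simp add: group_inverse_eqI[OF X])
qed

end
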